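(* Let $g\in\{1,\ldots,2^{n_-}\}$ and $(h,i,h)\in\mathbb{C}_g$. Then $n_{h,i,h}$ is independent of the choice of $(h,i,h)\in\mathbb{C}_g$, and the $\mathbb{F}$-dimension of the block algebra $\mathbb{T}D_g$ of $\mathbb{T}$ is $$4^{\,n-n_+-n_{h,i,h}}\,5^{\,n_+}.$$
   Context: Setting. Let $\mathbb{F}$ be a field of characteristic $p$ (possibly $p=0$; $0\mid m$ iff $m=0$). For an integer $m$, $\overline{m}$ is its image in $\mathbb{F}$. Let $n\ge 1$, let $\mathbb{U}_1,\ldots,\mathbb{U}_n$ be finite sets with $|\mathbb{U}_a|\ge 2$, let $\mathbb{X}=\prod_{a=1}^n\mathbb{U}_a$, and fix $\mathbf{x}\in\mathbb{X}$. Let $\mathbb{E}$ be the set of all subsets of $[n]=\{1,\ldots,n\}$ (the paper uses tuples in $\{0,1\}^n$; here a tuple is identified with its support). For $h\in\mathbb{E}$ let $R_h=\{(y,z)\in\mathbb{X}\times\mathbb{X}: y_a\neq z_a \text{ iff } a\in h\}$; $(\mathbb{X},\{R_h\}_{h\in\mathbb{E}})$ is the factorial association scheme. In the full matrix algebra $\mathrm{M}_\mathbb{X}(\mathbb{F})$, $A_h$ is the adjacency matrix of $R_h$, and $E_h^*$ is the diagonal matrix whose $(y,y)$-entry is $1$ if $(\mathbf{x},y)\in R_h$ and $0$ otherwise. The Terwilliger $\mathbb{F}$-algebra $\mathbb{T}$ is the $\mathbb{F}$-subalgebra of $\mathrm{M}_\mathbb{X}(\mathbb{F})$ generated by all $A_h$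 and $E_h^*$, $h\in\mathbb{E}$. Notation. $k_h=\prod_{a\in h}(|\mathbb{U}_a|-1)$ (with $k_\varnothing=1$). For $V\subseteq[n]$: $V^\circ=\{a\in V: |\mathbb{U}_a|\neq 2\}$, $V^+=\{a\in V: p\mid |\mathbb{U}_a|-1\}$, $V^-=\{a\in V: |\mathbb{U}_a|\ne 2,\ p\nmid|\mathbb{U}_a|-1\}$; $n_\pm=|[n]^\pm|$. For $a,b,c\in\mathbb{E}$, $n_{a,b,c}=|(a\cap c)^-\setminus b|$. $\triangle$ is symmetric difference. $\mathbb{P}=\{(a,b,c)\in\mathbb{E}^3: a\triangle c\subseteq b\subseteq (a\triangle c)\cup(a\cap c)^\circ\}$, and for $(a,b,c)\in\mathbb{P}$, $B_{a,b,c}=\sum_{a\triangle c\subseteq j\subseteq b}E_a^*A_jE_c^*$. For $(a,b,c)\in\mathbb{P}$ with $p\nmid k_b$, $$D_{a,b,c}=\sum_{q}(\overline{-1})^{|q\setminus b|}\,\overline{k_{c\cap q}}^{\,-1}B_{a,q,c},$$ the sum over all $q\in\mathbb{E}$ with $b\subseteq q\subseteq (a\triangle c)\cup(a\cap c)^\circ$ and $p\nmid k_q$. On $\{(a,b,a)\in\mathbb{P}: p\nmid k_b\}$ put $(a,b,a)\approx(a',b',a')$ iff $a^-\setminus b=a'^-\setminus b'$. This is an equivalence relation with exactly $2^{n_-}$ classes; enumerate them as $\mathbb{C}_1,\ldots,\mathbb{C}_{2^{n_-}}$. For $m\in\{1,\ldots,2^{n_-}\}$ let $D_m=\sum_{(a,b,a)\in\mathbb{C}_m}D_{a,b,a}$.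 The matrices $D_1,\ldots,D_{2^{n_-}}$ are the primitive idempotents of the center of $\mathbb{T}$ (block idempotents), and $\mathbb{T}D_g$ is called a block algebra of $\mathbb{T}$; it is an algebra with identity $D_g$. *)

theory Defs
  imports "HOL-Computational_Algebra.Computational_Algebra"
    "HOL-Library.Function_Algebras" "HOL-Library.FuncSet"
begin

section \<open>The full matrix algebra on a finite index set\<close>

text \<open>A matrix with rows and columns indexed by a set \<open>X\<close> is a binary function that vanishes outside
  \<open>X \<times> X\<close>. Sums of matrices are the pointwise sums of \<^theory>\<open>HOL-Library.Function_Algebras\<close>; the
  pointwise \<open>*\<close> and \<open>1\<close> of that theory are not the matrix product and the identity matrix.\<close>

type_synonym ('x, 'f) matr = "'x \<Rightarrow> 'x \<Rightarrow> 'f"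

definition mat_space :: "'x set \<Rightarrow> ('x, 'f::zero) matr set" where
  "mat_space X = {M. \<forall>y z. y \<notin> X \<or> z \<notin> X \<longrightarrow> M y z = 0}"

definition mat_scale :: "'f::times \<Rightarrow> ('x, 'f) matr \<Rightarrow> ('x, 'f) matr" where
  "mat_scale c M = (\<lambda>y z. c * M y z)"

definition mat_mult :: "'x set \<Rightarrow> ('x, 'f::semiring_0) matr \<Rightarrow> ('x, 'f) matr \<Rightarrow> ('x, 'f) matr" where
  "mat_mult X M N = (\<lambda>y z. \<Sum>w\<in>X. M y w * N w z)"

definition mat_id :: "'x set \<Rightarrow> ('x, 'f::zero_neq_one) matr" where
  "mat_id X = (\<lambda>y z. of_bool (y \<in> X \<and> y = z))"

lemma vector_space_mat_scale:
  "vector_space (mat_scale :: 'f::field \<Rightarrow> ('x, 'f) matr \<Rightarrow> ('x, 'f) matr)"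
  by unfold_locales (auto simp: mat_scale_def fun_eq_iff algebra_simps)

abbreviation mat_dim :: "('x, 'f::field) matr set \<Rightarrow> nat" where
  "mat_dim \<equiv> vector_space.dim mat_scale"

definition is_subalgebra :: "'x set \<Rightarrow> ('x, 'f::field) matr set \<Rightarrow> bool" where
  "is_subalgebra X S \<longleftrightarrow> S \<subseteq> mat_space X \<and> module.subspace mat_scale S \<and> mat_id X \<in> S \<and>
     (\<forall>M\<in>S. \<forall>N\<in>S. mat_mult X M N \<in> S)"

section \<open>The factorial scheme and its Terwilliger algebra\<close>

text \<open>\<open>U\<close> is the family of alphabets, used at the indices \<open>1, \<dots>, n\<close> only.\<close>

definition XX :: "nat \<Rightarrow> (nat \<Rightarrow> 'u set) \<Rightarrow> (nat \<Rightarrow> 'u) set" where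
  "XX n U = (\<Pi>\<^sub>E a\<in>{1..n}. U a)"

definition EE :: "nat \<Rightarrow> nat set set" where
  "EE n = Pow {1..n}"

definition R_rel :: "nat \<Rightarrow> (nat \<Rightarrow> 'u set) \<Rightarrow> nat set \<Rightarrow> ((nat \<Rightarrow> 'u) \<times> (nat \<Rightarrow> 'u)) set" where
  "R_rel n U h = {(y, z) \<in> XX n U \<times> XX n U. \<forall>a\<in>{1..n}. y a \<noteq> z a \<longleftrightarrow> a \<in> h}"

definition adj :: "nat \<Rightarrow> (nat \<Rightarrow> 'u set) \<Rightarrow> nat set \<Rightarrow> (nat \<Rightarrow> 'u, 'f::zero_neq_one) matr" where
  "adj n U h = (\<lambda>y z. of_bool ((y, z) \<in> R_rel n U h))"

definition Estar ::
  "nat \<Rightarrow> (nat \<Rightarrow> 'u set) \<Rightarrow> (nat \<Rightarrow> 'u) \<Rightarrow> nat set \<Rightarrow> (nat \<Rightarrow> 'u, 'f::zero_neq_one) matr" where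
  "Estar n U x h = (\<lambda>y z. of_bool (y = z \<and> (x, y) \<in> R_rel n U h))"

definition Terwilliger ::
  "nat \<Rightarrow> (nat \<Rightarrow> 'u set) \<Rightarrow> (nat \<Rightarrow> 'u) \<Rightarrow> (nat \<Rightarrow> 'u, 'f::field) matr set" where
  "Terwilliger n U x =
     is_subalgebra (XX n U) hull (adj n U ` EE n \<union> Estar n U x ` EE n)"

section \<open>Combinatorial data\<close>

text \<open>In what follows \<open>p\<close> is the characteristic of the base field, with \<open>p = 0\<close> in characteristic
  zero; the convention that \<open>0\<close> divides only \<open>0\<close> is that of \<open>dvd\<close>.\<close>

definition k_val :: "(nat \<Rightarrow> 'u set) \<Rightarrow> nat set \<Rightarrow> nat" where
  "k_val U h = (\<Prod>a\<in>h. card (U a) - 1)"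

definition circ :: "(nat \<Rightarrow> 'u set) \<Rightarrow> nat set \<Rightarrow> nat set" where
  "circ U V = {a\<in>V. card (U a) \<noteq> 2}"

definition plus_part :: "nat \<Rightarrow> (nat \<Rightarrow> 'u set) \<Rightarrow> nat set \<Rightarrow> nat set" where
  "plus_part p U V = {a\<in>V. p dvd card (U a) - 1}"

definition minus_part :: "nat \<Rightarrow> (nat \<Rightarrow> 'u set) \<Rightarrow> nat set \<Rightarrow> nat set" where
  "minus_part p U V = {a\<in>V. card (U a) \<noteq> 2 \<and> \<not> p dvd card (U a) - 1}"

definition n_plus :: "nat \<Rightarrow> nat \<Rightarrow> (nat \<Rightarrow> 'u set) \<Rightarrow> nat" where
  "n_plus p n U = card (plus_part p U {1..n})"

definition n_minus :: "nat \<Rightarrow> nat \<Rightarrow> (nat \<Rightarrow> 'u set) \<Rightarrow> nat" where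
  "n_minus p n U = card (minus_part p U {1..n})"

definition n_triple :: "nat \<Rightarrow> (nat \<Rightarrow> 'u set) \<Rightarrow> nat set \<Rightarrow> nat set \<Rightarrow> nat set \<Rightarrow> nat" where
  "n_triple p U a b c = card (minus_part p U (a \<inter> c) - b)"

definition PP :: "nat \<Rightarrow> (nat \<Rightarrow> 'u set) \<Rightarrow> (nat set \<times> nat set \<times> nat set) set" where
  "PP n U = {(a, b, c). a \<in> EE n \<and> b \<in> EE n \<and> c \<in> EE n \<and>
     sym_diff a c \<subseteq> b \<and> b \<subseteq> sym_diff a c \<union> circ U (a \<inter> c)}"

section \<open>The block idempotents\<close>

definition B_mat ::
  "nat \<Rightarrow> (nat \<Rightarrow> 'u set) \<Rightarrow> (nat \<Rightarrow> 'u) \<Rightarrow> nat set \<Rightarrow> nat set \<Rightarrow> nat set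
    \<Rightarrow> (nat \<Rightarrow> 'u, 'f::field) matr" where
  "B_mat n U x a b c = (\<Sum>j | sym_diff a c \<subseteq> j \<and> j \<subseteq> b.
     mat_mult (XX n U) (mat_mult (XX n U) (Estar n U x a) (adj n U j)) (Estar n U x c))"

definition D_mat ::
  "nat \<Rightarrow> (nat \<Rightarrow> 'u set) \<Rightarrow> (nat \<Rightarrow> 'u) \<Rightarrow> nat set \<Rightarrow> nat set \<Rightarrow> nat set
    \<Rightarrow> (nat \<Rightarrow> 'u, 'f::field) matr" where
  "D_mat n U x a b c =
     (\<Sum>q | q \<in> EE n \<and> b \<subseteq> q \<and> q \<subseteq> sym_diff a c \<union> circ U (a \<inter> c) \<and> \<not> CHAR('f) dvd k_val U q.
        mat_scale ((- 1) ^ card (q - b) * inverse (of_nat (k_val U (c \<inter> q)))) (B_mat n U x a q c))"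

definition diag_triples ::
  "nat \<Rightarrow> nat \<Rightarrow> (nat \<Rightarrow> 'u set) \<Rightarrow> (nat set \<times> nat set \<times> nat set) set" where
  "diag_triples p n U = {(a, b, c) \<in> PP n U. a = c \<and> \<not> p dvd k_val U b}"

definition approx_rel ::
  "nat \<Rightarrow> nat \<Rightarrow> (nat \<Rightarrow> 'u set)
    \<Rightarrow> ((nat set \<times> nat set \<times> nat set) \<times> (nat set \<times> nat set \<times> nat set)) set" where
  "approx_rel p n U =
     {((a, b, c), (a', b', c')). (a, b, c) \<in> diag_triples p n U \<and> (a', b', c') \<in> diag_triples p n U \<and>
        minus_part p U a - b = minus_part p U a' - b'}"

definition D_class ::
  "nat \<Rightarrow> (nat \<Rightarrow> 'u set) \<Rightarrow> (nat \<Rightarrow> 'u) \<Rightarrow> (nat set \<times> nat set \<times> nat set) set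
    \<Rightarrow> (nat \<Rightarrow> 'u, 'f::field) matr" where
  "D_class n U x C = (\<Sum>(a, b, c)\<in>C. D_mat n U x a b c)"

definition block_algebra ::
  "nat \<Rightarrow> (nat \<Rightarrow> 'u set) \<Rightarrow> (nat \<Rightarrow> 'u) \<Rightarrow> (nat set \<times> nat set \<times> nat set) set
    \<Rightarrow> (nat \<Rightarrow> 'u, 'f::field) matr set" where
  "block_algebra n U x C = (\<lambda>M. mat_mult (XX n U) M (D_class n U x C)) ` Terwilliger n U x"

text \<open>There are exactly \<open>2 ^ n_minus p n U\<close> classes, so they can be enumerated by
  \<open>1, \<dots>, 2 ^ n_minus p n U\<close>.\<close>

lemma equiv_approx_rel: "equiv (diag_triples p n U) (approx_rel p n U)"
  by (auto simp: equiv_def refl_on_def sym_on_def trans_on_def approx_rel_def)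

lemma card_approx_classes:
  assumes "p \<noteq> 1"
  shows "card (diag_triples p n U // approx_rel p n U) = 2 ^ n_minus p n U"
proof -
  let ?A = "diag_triples p n U" and ?r = "approx_rel p n U"
  let ?S = "minus_part p U {1..n}"
  let ?rep = "\<lambda>s::nat set. (s, {} :: nat set, s)"
  have rep: "?rep s \<in> ?A" if "s \<subseteq> ?S" for s
    using that assms by (auto simp: diag_triples_def PP_def EE_def minus_part_def k_val_def)
  have rep_minus: "minus_part p U s = s" if "s \<subseteq> ?S" for s
    using that by (auto simp: minus_part_def)
  have "bij_betw (\<lambda>s. ?r `` {?rep s}) (Pow ?S) (?A // ?r)"
  proof (rule bij_betw_imageI)
    show "inj_on (\<lambda>s. ?r `` {?rep s}) (Pow ?S)"
    proof (rule inj_onI)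
      fix s t assume st: "s \<in> Pow ?S" "t \<in> Pow ?S" and eq: "?r `` {?rep s} = ?r `` {?rep t}"
      have "(?rep s, ?rep t) \<in> ?r"
        using eq_equiv_class[OF eq equiv_approx_rel] rep st by blast
      then show "s = t"
        using st rep_minus by (auto simp: approx_rel_def)
    qed
    show "(\<lambda>s. ?r `` {?rep s}) ` Pow ?S = ?A // ?r"
    proof (intro equalityI subsetI)
      fix c assume "c \<in> (\<lambda>s. ?r `` {?rep s}) ` Pow ?S"
      then show "c \<in> ?A // ?r"
        using rep by (auto intro: quotientI)
    next
      fix c assume "c \<in> ?A // ?r"
      then obtain t where t: "t \<in> ?A" "c = ?r `` {t}"
        by (auto elim: quotientE)
      then obtain a b where ab: "t = (a, b, a)"
        by (auto simp: diag_triples_def)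
      define s where "s = minus_part p U a - b"
      have "a \<subseteq> {1..n}"
        using t ab by (auto simp: diag_triples_def PP_def EE_def)
      then have s: "s \<subseteq> ?S"
        by (auto simp: s_def minus_part_def)
      have "(?rep s, t) \<in> ?r"
        using rep[OF s] rep_minus[OF s] t(1) ab by (simp add: approx_rel_def s_def)
      then have "?r `` {?rep s} = c"
        using equiv_class_eq[OF equiv_approx_rel] t(2) by blast
      then show "c \<in> (\<lambda>s. ?r `` {?rep s}) ` Pow ?S"
        using s by blast
    qed
  qed
  then have "card (?A // ?r) = card (Pow ?S)"
    by (simp add: bij_betw_same_card)
  moreover have "finite ?S"
    by (simp add: minus_part_def)
  ultimately show ?thesis
    by (simp add: card_Pow n_minus_def)
qed

end

(* The Terwilliger algebra is the tensor product over a of the algebras T_a belonging to the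
   one-class schemes on U_a. If |U_a| = 2, then T_a = M_2(F); otherwise T_a has dimension 5. With
   k = |U_a| - 1 and I, J the identity and all-ones matrix on U_a - {x_a}, the algebra T_a splits for
   |U_a| > 2 and k invertible along the central idempotent I - J/k into blocks of dimension 4 and 1,
   and this idempotent is not available if k = 0 in F. Expanding tensor products shows that the class
   with a^- - b = s gives the tensor product of I - J/k at the places in s, of the complementary
   idempotent at the other places of [n]^-, and of the identity elsewhere. Hence its block has
   dimension 1 at each place in s, 5 at each place in [n]^+ and 4 at all others. *)

theory Submission
  imports Defs
begin

section \<open>Auxiliary linear algebra and finite products\<close>

interpretation mat: vector_space
  "mat_scale :: 'f::field \<Rightarrow> ('x, 'f) matr \<Rightarrow> ('x, 'f) matr"
  by (rule vector_space_mat_scale)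

text \<open>Applied to a vanishing combination, \<open>\<Phi> g\<close> returns the coefficient of
  \<open>b g\<close>, so the vectors are independent. Duality also makes \<open>b\<close> injective
  on \<open>F\<close>, so that \<open>card F\<close> counts vectors and not just indices.\<close>

lemma (in vector_space) dim_span_dual_family:
  assumes F: "finite F"
    and lin: "\<And>g c. g \<in> F \<Longrightarrow> \<Phi> g (\<Sum>f\<in>F. scale (c f) (b f)) = (\<Sum>f\<in>F. c f * \<Phi> g (b f))"
    and dual: "\<And>f g. f \<in> F \<Longrightarrow> g \<in> F \<Longrightarrow> \<Phi> g (b f) = of_bool (f = g)"
  shows "dim (span (b ` F)) = card F"
proof -
  have inj: "inj_on b F"
  proof (rule inj_onI)
    fix f g assume "f \<in> F" "g \<in> F" "b f = b g"
    then show "f = g" using dual[of f g] dual[of g g] by (auto split: if_splits)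
  qed
  have zero: "\<Phi> g 0 = 0" if "g \<in> F" for g
    using lin[OF that, of "\<lambda>_. 0"] by simp
  have "independent (b ` F)"
  proof (rule independent_if_scalars_zero)
    fix c v assume 0: "(\<Sum>v\<in>b ` F. scale (c v) v) = 0" and v: "v \<in> b ` F"
    then obtain g where g: "g \<in> F" "v = b g" by blast
    have "(\<Sum>f\<in>F. scale (c (b f)) (b f)) = 0"
      using 0 by (simp add: sum.reindex[OF inj])
    then have "0 = (\<Sum>f\<in>F. c (b f) * \<Phi> g (b f))"
      using lin[OF g(1), of "\<lambda>f. c (b f)"] zero[OF g(1)] by simp
    also have "\<dots> = (\<Sum>f\<in>F. if f = g then c (b f) else 0)"
      by (rule sum.cong) (auto simp: dual g)
    also have "\<dots> = c v" using F g by simp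
    finally show "c v = 0" by simp
  qed (use F in auto)
  then show ?thesis
    by (simp add: dim_span dim_eq_card_independent card_image[OF inj])
qed

lemma sum_matr_apply: "(\<Sum>i\<in>A. f i) y z = (\<Sum>i\<in>A. f i y z)"
  for f :: "'i \<Rightarrow> ('x, 'f::comm_monoid_add) matr"
  by (induction A rule: infinite_finite_induct) auto

lemma prod_of_bool:
  "finite A \<Longrightarrow> (\<Prod>a\<in>A. of_bool (P a)) = (of_bool (\<forall>a\<in>A. P a) :: 'f::comm_semiring_1)"
  by (induction A rule: finite_induct) auto

section \<open>One tensor factor\<close>

text \<open>The coefficients \<open>v 0, v 1, v 2, v 3\<close> belong to the all-ones matrices of the four blocks cut out
  by \<open>x\<close> and its complement, \<open>v 4\<close> to the identity of the complement. On a two-element set the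
  matrices of \<open>v 3\<close> and \<open>v 4\<close> coincide. Only arguments up to \<open>4\<close> matter.\<close>

definition loc :: "'u \<Rightarrow> (nat \<Rightarrow> 'f::field) \<Rightarrow> 'u \<Rightarrow> 'u \<Rightarrow> 'f" where
  "loc x v y z =
     (if y = x then if z = x then v 0 else v 1
      else if z = x then v 2 else v 3 + v 4 * of_bool (y = z))"

text \<open>Structure constants of one tensor factor, with \<open>k\<close> for the size of the
  complement of \<open>x\<close>: a row of ones times a column of ones gives \<open>k\<close>, and
  the all-ones matrix of the complement squares to \<open>k\<close> times itself.\<close>

definition loc_mult :: "'f::field \<Rightarrow> (nat \<Rightarrow> 'f) \<Rightarrow> (nat \<Rightarrow> 'f) \<Rightarrow> nat \<Rightarrow> 'f" where
  "loc_mult k v w j =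
     (if j = 0 then v 0 * w 0 + k * v 1 * w 2
      else if j = 1 then v 0 * w 1 + v 1 * (k * w 3 + w 4)
      else if j = 2 then v 2 * w 0 + (k * v 3 + v 4) * w 2
      else if j = 3 then v 2 * w 1 + v 3 * w 4 + v 4 * w 3 + k * v 3 * w 3
      else v 4 * w 4)"

lemma loc_mult_eq:
  fixes v v' :: "nat \<Rightarrow> 'f::field"
  assumes U: "finite U" "x \<in> U" and yz: "y \<in> U" "z \<in> U"
  shows "(\<Sum>w\<in>U. loc x v y w * loc x v' w z) =
    loc x (loc_mult (of_nat (card U - 1)) v v') y z"
proof -
  have *: "(\<Sum>w\<in>U - {x}. of_bool (y = w) * of_bool (w = z)) = (of_bool (y = z) :: 'f)"
    if "y \<noteq> x"
  proof -
    have "(\<Sum>w\<in>U - {x}. of_bool (y = w) * of_bool (w = z))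
      = (\<Sum>w\<in>U - {x}. if y = w then of_bool (w = z) else (0::'f))"
      by (rule sum.cong) auto
    then show ?thesis using that U yz by simp
  qed
  have e1: "(\<Sum>w\<in>U - {x}. of_bool (y = w)) = (1::'f)" if "y \<noteq> x"
  proof -
    have "(\<Sum>w\<in>U - {x}. of_bool (y = w)) = (\<Sum>w\<in>U - {x}. if y = w then 1 else (0::'f))"
      by (rule sum.cong) auto
    then show ?thesis using that U yz by simp
  qed
  have e2: "(\<Sum>w\<in>U - {x}. of_bool (w = z)) = (1::'f)" if "z \<noteq> x"
  proof -
    have "(\<Sum>w\<in>U - {x}. of_bool (w = z)) = (\<Sum>w\<in>U - {x}. if w = z then 1 else (0::'f))"
      by (rule sum.cong) auto
    then show ?thesis using that U yz by simp
  qed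
  have card: "(\<Sum>w\<in>U - {x}. 1) = (of_nat (card U - 1) :: 'f)"
    using U by simp
  \<comment> \<open>For \<open>w\<close> other than \<open>x\<close> the two entries are
    \<open>?a + ?b * of_bool (y = w)\<close> and \<open>?c + ?d * of_bool (w = z)\<close>. Their
    product expands into the four kinds of sums evaluated above.\<close>
  let ?a = "if y = x then v 1 else v 3" and ?b = "if y = x then 0 else v 4"
  let ?c = "if z = x then v' 2 else v' 3" and ?d = "if z = x then 0 else v' 4"
  have "(\<Sum>w\<in>U. loc x v y w * loc x v' w z) =
      loc x v y x * loc x v' x z + (\<Sum>w\<in>U - {x}. loc x v y w * loc x v' w z)"
    using U by (simp add: sum.remove)
  also have "(\<Sum>w\<in>U - {x}. loc x v y w * loc x v' w z) =
      (\<Sum>w\<in>U - {x}. ?a * ?c * 1 + ?a * ?d * of_bool (w = z) + ?b * ?c * of_bool (y = w)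
         + ?b * ?d * (of_bool (y = w) * of_bool (w = z)))"
    by (rule sum.cong) (auto simp: loc_def algebra_simps)
  also have "\<dots> = ?a * ?c * of_nat (card U - 1) + ?a * ?d + ?b * ?c + ?b * ?d * of_bool (y = z)"
    unfolding sum.distrib sum_distrib_left[symmetric] card
    using * e1 e2 by (cases "y = x"; cases "z = x") simp_all
  finally show ?thesis
    by (auto simp: loc_def loc_mult_def algebra_simps)
qed

section \<open>Tensor products\<close>

text \<open>A Kronecker product, encoded by the coefficients of its local factors so that products
  can be computed by \<open>loc_mult\<close>. Different \<open>v\<close> can give the same
  matrix.\<close>

definition ten ::
  "nat \<Rightarrow> (nat \<Rightarrow> 'u set) \<Rightarrow> (nat \<Rightarrow> 'u) \<Rightarrow> (nat \<Rightarrow> nat \<Rightarrow> 'f::field) \<Rightarrow> (nat \<Rightarrow> 'u, 'f) matr" where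
  "ten n U x v = (\<lambda>y z. of_bool (y \<in> XX n U \<and> z \<in> XX n U) *
     (\<Prod>c\<in>{1..n}. loc (x c) (v c) (y c) (z c)))"

lemma loc_cong: "(\<And>j. j \<le> 4 \<Longrightarrow> v j = w j) \<Longrightarrow> loc x v = loc x w"
  by (simp add: loc_def fun_eq_iff)

lemma ten_cong:
  "(\<And>c j. c \<in> {1..n} \<Longrightarrow> j \<le> 4 \<Longrightarrow> v c j = w c j) \<Longrightarrow> ten n U x v = ten n U x w"
  unfolding ten_def by (intro ext arg_cong2[where f = "(*)"] refl prod.cong) (auto cong: loc_cong)

text \<open>Multilinearity: a product of local sums is a sum over choice functions. This expands
  tensors in units and, read backwards, collapses the sum that defines a block idempotent.\<close>

lemma ten_expand:
  assumes K: "\<And>c. c \<in> {1..n} \<Longrightarrow> finite (K c)"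
    and v: "\<And>c j. c \<in> {1..n} \<Longrightarrow> j \<le> 4 \<Longrightarrow> v c j = (\<Sum>k\<in>K c. \<beta> c k * N c k j)"
  shows "ten n U x v =
    (\<Sum>f\<in>Pi\<^sub>E {1..n} K. mat_scale (\<Prod>c\<in>{1..n}. \<beta> c (f c)) (ten n U x (\<lambda>c. N c (f c))))"
proof (intro ext)
  fix y z
  have "loc (x c) (v c) (y c) (z c) = (\<Sum>k\<in>K c. \<beta> c k * loc (x c) (N c k) (y c) (z c))"
    if "c \<in> {1..n}" for c
    using v[OF that]
    by (auto simp: loc_def sum.distrib algebra_simps sum_distrib_left sum_distrib_right)
  then have "(\<Prod>c\<in>{1..n}. loc (x c) (v c) (y c) (z c)) =
      (\<Prod>c\<in>{1..n}. \<Sum>k\<in>K c. \<beta> c k * loc (x c) (N c k) (y c) (z c))"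
    by (rule prod.cong[OF refl])
  also have "\<dots> = (\<Sum>f\<in>Pi\<^sub>E {1..n} K. \<Prod>c\<in>{1..n}. \<beta> c (f c) * loc (x c) (N c (f c)) (y c) (z c))"
    by (rule prod_sum_PiE) (use K in auto)
  finally show "ten n U x v y z = (\<Sum>f\<in>Pi\<^sub>E {1..n} K.
      mat_scale (\<Prod>c\<in>{1..n}. \<beta> c (f c)) (ten n U x (\<lambda>c. N c (f c)))) y z"
    by (simp add: ten_def sum_matr_apply mat_scale_def prod.distrib sum_distrib_left mult_ac)
qed

text \<open>Mixed product rule: a point of \<open>XX n U\<close> is a choice of one \<open>u\<close>
  at each place, so the sum over the middle index factors into the local sums of
  \<open>loc_mult_eq\<close>.\<close>

lemma ten_mult:
  assumes U: "\<And>a. a \<in> {1..n} \<Longrightarrow> finite (U a)" and x: "x \<in> XX n U"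
  shows "mat_mult (XX n U) (ten n U x v) (ten n U x w) =
    ten n U x (\<lambda>c. loc_mult (of_nat (card (U c) - 1)) (v c) (w c))"
proof (intro ext)
  fix y z
  show "mat_mult (XX n U) (ten n U x v) (ten n U x w) y z =
    ten n U x (\<lambda>c. loc_mult (of_nat (card (U c) - 1)) (v c) (w c)) y z"
  proof (cases "y \<in> XX n U \<and> z \<in> XX n U")
    case True
    have "(\<Prod>c\<in>{1..n}. loc (x c) (loc_mult (of_nat (card (U c) - 1)) (v c) (w c)) (y c) (z c)) =
        (\<Prod>c\<in>{1..n}. \<Sum>u\<in>U c. loc (x c) (v c) (y c) u * loc (x c) (w c) u (z c))"
      using U x True by (intro prod.cong refl loc_mult_eq[symmetric]) (auto simp: XX_def)
    also have "\<dots> = (\<Sum>u\<in>XX n U. \<Prod>c\<in>{1..n}.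
        loc (x c) (v c) (y c) (u c) * loc (x c) (w c) (u c) (z c))"
      unfolding XX_def by (rule prod_sum_PiE) (use U in auto)
    finally show ?thesis using True
      by (simp add: mat_mult_def ten_def prod.distrib)
  qed (auto simp: mat_mult_def ten_def)
qed

lemma ten_in_mat_space: "ten n U x v \<in> mat_space (XX n U)"
  by (auto simp: mat_space_def ten_def)

section \<open>Placewise 0-1 conditions: generators and the matrices \<open>B_mat\<close> as
  tensors\<close>

lemma ten_eq_of_bool:
  assumes "\<And>c. c \<in> {1..n} \<Longrightarrow> loc (x c) (v c) (y c) (z c) = of_bool (P c)"
  shows "ten n U x v y z = of_bool (y \<in> XX n U \<and> z \<in> XX n U \<and> (\<forall>c\<in>{1..n}. P c))"
proof -
  have "(\<Prod>c\<in>{1..n}. loc (x c) (v c) (y c) (z c)) = (\<Prod>c\<in>{1..n}. of_bool (P c))"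
    using assms by (rule prod.cong[OF refl])
  then show ?thesis
    unfolding ten_def by (simp only: prod_of_bool finite_atLeastAtMost) simp
qed

lemma XX_eq_iff:
  "y \<in> XX n U \<Longrightarrow> z \<in> XX n U \<Longrightarrow> y = z \<longleftrightarrow> (\<forall>c\<in>{1..n}. y c = z c)"
  unfolding XX_def by (auto intro: PiE_ext)

lemma mat_id_eq_ten:
  "mat_id (XX n U) = ten n U x (\<lambda>c j. of_bool (j = 0 \<or> j = 4))"
proof (intro ext)
  fix y z
  have "ten n U x (\<lambda>c j. of_bool (j = 0 \<or> j = 4) :: 'b) y z =
      of_bool (y \<in> XX n U \<and> z \<in> XX n U \<and> (\<forall>c\<in>{1..n}. y c = z c))"
    by (rule ten_eq_of_bool) (auto simp: loc_def)
  then show "mat_id (XX n U) y z = ten n U x (\<lambda>c j. of_bool (j = 0 \<or> j = 4) :: 'b) y z"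
    using XX_eq_iff[of y n U z] by (auto simp: mat_id_def)
qed

text \<open>At a place in \<open>h\<close> the factor is all-ones minus identity; on the complement
  of \<open>x c\<close> this means \<open>v 3 = 1\<close> and \<open>v 4 = - 1\<close>. Elsewhere
  the factor is the identity.\<close>

lemma adj_eq_ten:
  "adj n U h = ten n U x (\<lambda>c j. if c \<in> h then of_bool (j \<in> {1, 2, 3}) - of_bool (j = 4)
     else of_bool (j = 0 \<or> j = 4))"
proof (intro ext)
  fix y z
  have "ten n U x (\<lambda>c j. if c \<in> h then of_bool (j \<in> {1, 2, 3}) - of_bool (j = 4)
     else of_bool (j = 0 \<or> j = 4) :: 'b) y z =
      of_bool (y \<in> XX n U \<and> z \<in> XX n U \<and> (\<forall>c\<in>{1..n}. y c \<noteq> z c \<longleftrightarrow> c \<in> h))"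
    by (rule ten_eq_of_bool) (auto simp: loc_def)
  then show "adj n U h y z = ten n U x (\<lambda>c j. if c \<in> h then of_bool (j \<in> {1, 2, 3}) - of_bool (j = 4)
     else of_bool (j = 0 \<or> j = 4) :: 'b) y z"
    by (simp add: adj_def R_rel_def)
qed

lemma Estar_eq_ten:
  assumes x: "x \<in> XX n U"
  shows "Estar n U x h = ten n U x (\<lambda>c j. of_bool (j = (if c \<in> h then 4 else 0)))"
proof (intro ext)
  fix y z
  have "ten n U x (\<lambda>c j. of_bool (j = (if c \<in> h then 4 else 0)) :: 'b) y z =
      of_bool (y \<in> XX n U \<and> z \<in> XX n U \<and> (\<forall>c\<in>{1..n}. y c = z c \<and> (x c \<noteq> y c \<longleftrightarrow> c \<in> h)))"
    by (rule ten_eq_of_bool) (auto simp: loc_def)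
  then show "Estar n U x h y z =
      ten n U x (\<lambda>c j. of_bool (j = (if c \<in> h then 4 else 0)) :: 'b) y z"
    using x XX_eq_iff[of y n U z] by (auto simp: Estar_def R_rel_def)
qed

lemma finite_XX: "(\<And>a. a \<in> {1..n} \<Longrightarrow> finite (U a)) \<Longrightarrow> finite (XX n U)"
  unfolding XX_def by (rule finite_PiE) auto

lemma Estar_adj_Estar:
  assumes "finite (XX n U)"
  shows "mat_mult (XX n U) (mat_mult (XX n U) (Estar n U x a) (adj n U j)) (Estar n U x c) y z =
    (of_bool ((x, y) \<in> R_rel n U a \<and> (y, z) \<in> R_rel n U j \<and> (x, z) \<in> R_rel n U c) :: 'f::field)"
proof -
  have 1: "mat_mult (XX n U) (Estar n U x a) (adj n U j) y w =
      (of_bool ((x, y) \<in> R_rel n U a \<and> (y, w) \<in> R_rel n U j) :: 'f)" for w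
  proof -
    have "mat_mult (XX n U) (Estar n U x a) (adj n U j) y w =
        (\<Sum>u\<in>XX n U. if u = y then
           (of_bool ((x, y) \<in> R_rel n U a \<and> (y, w) \<in> R_rel n U j) :: 'f) else 0)"
      unfolding mat_mult_def by (rule sum.cong) (auto simp: Estar_def adj_def)
    also have "\<dots> = of_bool ((x, y) \<in> R_rel n U a \<and> (y, w) \<in> R_rel n U j)"
      using assms by (auto simp: R_rel_def)
    finally show ?thesis .
  qed
  have "mat_mult (XX n U) (mat_mult (XX n U) (Estar n U x a) (adj n U j)) (Estar n U x c) y z =
      (\<Sum>u\<in>XX n U. if u = z then (of_bool ((x, y) \<in> R_rel n U a \<and> (y, z) \<in> R_rel n U j \<and>
         (x, z) \<in> R_rel n U c) :: 'f) else 0)"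
    unfolding mat_mult_def[of _ "mat_mult _ _ _"] 1 by (rule sum.cong) (auto simp: Estar_def)
  also have "\<dots> = of_bool ((x, y) \<in> R_rel n U a \<and> (y, z) \<in> R_rel n U j \<and> (x, z) \<in> R_rel n U c)"
    using assms by (auto simp: R_rel_def)
  finally show ?thesis .
qed

text \<open>For given \<open>y\<close> and \<open>z\<close> only the set \<open>?d\<close> of places
  where they differ can contribute as \<open>j\<close>. At a place in exactly one of
  \<open>a\<close> and \<open>c\<close> exactly one of \<open>y\<close> and \<open>z\<close> agrees
  with \<open>x\<close>, so \<open>?d\<close> contains \<open>sym_diff a c\<close> anyway and only
  \<open>?d \<subseteq> b\<close> remains, a condition on each place.\<close>

lemma B_mat_eq_ten:
  assumes U: "finite (XX n U)" and x: "x \<in> XX n U"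
    and b: "b \<in> EE n" "sym_diff a c \<subseteq> b"
  shows "B_mat n U x a b c = (ten n U x (\<lambda>d j. of_bool (j =
     (if d \<in> a then if d \<in> c then if d \<in> b then 3 else 4 else 2 else if d \<in> c then 1 else 0)))
     :: (nat \<Rightarrow> 'u, 'f::field) matr)"
proof (intro ext)
  fix y z :: "nat \<Rightarrow> 'u"
  let ?v = "\<lambda>d j. of_bool (j =
     (if d \<in> a then if d \<in> c then if d \<in> b then 3 else 4 else 2 else if d \<in> c then 1 else 0)) :: 'f"
  let ?J = "{j. sym_diff a c \<subseteq> j \<and> j \<subseteq> b}"
  let ?d = "{d\<in>{1..n}. y d \<noteq> z d}"
  let ?P = "(x, y) \<in> R_rel n U a \<and> (x, z) \<in> R_rel n U c"
  have fin: "finite ?J"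
    using b by (intro finite_subset[of ?J "Pow b"]) (auto simp: EE_def intro: finite_subset)
  have "B_mat n U x a b c y z =
      (\<Sum>j\<in>?J. of_bool ((x, y) \<in> R_rel n U a \<and> (y, z) \<in> R_rel n U j \<and> (x, z) \<in> R_rel n U c) :: 'f)"
    unfolding B_mat_def sum_matr_apply by (simp only: Estar_adj_Estar[OF U])
  also have "\<dots> = (\<Sum>j\<in>?J. if j = ?d then of_bool ?P else 0)"
  proof (rule sum.cong)
    fix j assume j: "j \<in> ?J"
    have "(y, z) \<in> R_rel n U j \<longleftrightarrow> j = ?d" if ?P
      using that j b by (auto simp: R_rel_def EE_def)
    then show "of_bool ((x, y) \<in> R_rel n U a \<and> (y, z) \<in> R_rel n U j \<and> (x, z) \<in> R_rel n U c) =
      (if j = ?d then of_bool ?P else 0 :: 'f)"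
      by auto
  qed simp
  also have "\<dots> = of_bool (?P \<and> ?d \<subseteq> b)"
  proof (cases ?P)
    case True
    then have "sym_diff a c \<subseteq> ?d"
      using b by (fastforce simp: R_rel_def EE_def)
    then show ?thesis using fin True by (simp add: sum.delta)
  next
    case False
    then show ?thesis by (auto intro!: sum.neutral)
  qed
  also have "\<dots> = ten n U x ?v y z"
  proof -
    have "ten n U x ?v y z = of_bool (y \<in> XX n U \<and> z \<in> XX n U \<and> (\<forall>d\<in>{1..n}.
        (x d \<noteq> y d \<longleftrightarrow> d \<in> a) \<and> (x d \<noteq> z d \<longleftrightarrow> d \<in> c) \<and> (y d \<noteq> z d \<longrightarrow> d \<in> b)))"
      using b(2) by (intro ten_eq_of_bool) (auto simp: loc_def)
    then show ?thesis
      using x by (auto simp: R_rel_def)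
  qed
  finally show "B_mat n U x a b c y z = ten n U x ?v y z" .
qed

section \<open>The Terwilliger algebra\<close>

lemma module_hom_mat_mult_left:
  "module_hom mat_scale mat_scale (\<lambda>M :: ('x, 'f::field) matr. mat_mult X M N)"
  by unfold_locales
    (auto simp: mat_mult_def mat_scale_def fun_eq_iff sum.distrib algebra_simps sum_distrib_left)

lemma module_hom_mat_mult_right:
  "module_hom mat_scale mat_scale (\<lambda>N :: ('x, 'f::field) matr. mat_mult X M N)"
  by unfold_locales
    (auto simp: mat_mult_def mat_scale_def fun_eq_iff sum.distrib algebra_simps sum_distrib_left)

text \<open>Bilinearity, one argument at a time: first the left factor ranges over the span while
  the right one stays in \<open>S\<close>, then the right factor does.\<close>

lemma span_mat_mult_closed:
  assumes S: "\<And>M N. M \<in> S \<Longrightarrow> N \<in> S \<Longrightarrow> mat_mult X M N \<in> mat.span S"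
    and "M \<in> mat.span S" "N \<in> mat.span S"
  shows "mat_mult X M N \<in> mat.span S"
proof -
  have 1: "mat_mult X M N \<in> mat.span S" if "N \<in> S" "M \<in> mat.span S" for M N
  proof -
    interpret module_hom mat_scale mat_scale "\<lambda>M. mat_mult X M N"
      by (rule module_hom_mat_mult_left)
    have "mat.span S \<subseteq> (\<lambda>M. mat_mult X M N) -` mat.span S"
      using S that(1) by (intro mat.span_minimal subspace_vimage) auto
    then show ?thesis using that(2) by auto
  qed
  interpret module_hom mat_scale mat_scale "\<lambda>N. mat_mult X M N"
    by (rule module_hom_mat_mult_right)
  have "mat.span S \<subseteq> (\<lambda>N. mat_mult X M N) -` mat.span S"
    using 1 assms(2) by (intro mat.span_minimal subspace_vimage) auto
  then show ?thesis using assms(3) by auto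
qed

lemma subspace_mat_space: "mat.subspace (mat_space X)"
  by (auto simp: mat.subspace_def mat_space_def mat_scale_def)

text \<open>The span of the tensors contains the generators and is closed under products, which
  bounds the algebra from above. From below, each \<open>B_mat\<close> is a sum of products of
  generators, and all tensors of coefficient units are of this form.\<close>

lemma Terwilliger_eq_span:
  fixes U :: "nat \<Rightarrow> 'u set"
  assumes U: "\<And>a. a \<in> {1..n} \<Longrightarrow> finite (U a)" and x: "x \<in> XX n U"
  shows "Terwilliger n U x = mat.span (range (ten n U x :: _ \<Rightarrow> (nat \<Rightarrow> 'u, 'f::field) matr))"
proof
  let ?W = "mat.span (range (ten n U x :: _ \<Rightarrow> (nat \<Rightarrow> 'u, 'f) matr))"
  have ten: "ten n U x v \<in> ?W" for v
    by (rule mat.span_base) simp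
  have mult: "mat_mult (XX n U) (ten n U x v) (ten n U x w) =
      (ten n U x (\<lambda>c. loc_mult (of_nat (card (U c) - 1)) (v c) (w c)) :: (nat \<Rightarrow> 'u, 'f) matr)" for v w
    using U x by (rule ten_mult)
  have "is_subalgebra (XX n U) ?W"
    unfolding is_subalgebra_def
  proof (intro conjI ballI)
    show "?W \<subseteq> mat_space (XX n U)"
      using ten_in_mat_space by (intro mat.span_minimal subspace_mat_space) auto
    show "mat_id (XX n U) \<in> ?W"
      using ten by (simp only: mat_id_eq_ten[of n U x])
    show "mat_mult (XX n U) M N \<in> ?W" if "M \<in> ?W" "N \<in> ?W" for M N
      by (rule span_mat_mult_closed[OF _ that]) (auto simp only: mult ten)
  qed (rule mat.subspace_span)
  then show "Terwilliger n U x \<subseteq> ?W"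
    unfolding Terwilliger_def
  proof (rule hull_minimal[rotated])
    show "adj n U ` EE n \<union> Estar n U x ` EE n \<subseteq> ?W"
      using ten by (auto simp only: adj_eq_ten[of n U _ x] Estar_eq_ten[OF x])
  qed
  show "?W \<subseteq> Terwilliger n U x"
    unfolding Terwilliger_def hull_def
  proof (rule Inter_greatest)
    fix S :: "(nat \<Rightarrow> 'u, 'f) matr set"
    assume "S \<in> {t. is_subalgebra (XX n U) t \<and> adj n U ` EE n \<union> Estar n U x ` EE n \<subseteq> t}"
    then have sub: "mat.subspace S"
      and mult: "\<And>M N. M \<in> S \<Longrightarrow> N \<in> S \<Longrightarrow> mat_mult (XX n U) M N \<in> S"
      and adj: "\<And>j. j \<in> EE n \<Longrightarrow> adj n U j \<in> S"
      and Estar: "\<And>j. j \<in> EE n \<Longrightarrow> Estar n U x j \<in> S"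
      by (auto simp: is_subalgebra_def)
    have B: "B_mat n U x a b c \<in> S" if "a \<in> EE n" "b \<in> EE n" "c \<in> EE n" for a b c
      unfolding B_mat_def using that
      by (intro mat.subspace_sum[OF sub] mult adj Estar) (auto simp: EE_def)
    have unit: "ten n U x (\<lambda>c j. of_bool (j = f c)) \<in> S" if f: "f \<in> {1..n} \<rightarrow> {..4}" for f :: "nat \<Rightarrow> nat"
    proof -
      \<comment> \<open>\<open>?a\<close> and \<open>?c\<close> collect the places whose row,
        respectively column, lies off \<open>x\<close>. The codes 1 and 2 form
        \<open>sym_diff ?a ?c\<close>, which \<open>?b\<close> must contain; code 3 adds the places
        with an all-ones block.\<close>
      let ?a = "{d\<in>{1..n}. f d \<in> {2, 3, 4}}" and ?c = "{d\<in>{1..n}. f d \<in> {1, 3, 4}}"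
        and ?b = "{d\<in>{1..n}. f d \<in> {1, 2, 3}}"
      have "ten n U x (\<lambda>c j. of_bool (j = f c)) = (B_mat n U x ?a ?b ?c :: (nat \<Rightarrow> 'u, 'f) matr)"
      proof (subst B_mat_eq_ten)
        show "ten n U x (\<lambda>c j. of_bool (j = f c)) = (ten n U x (\<lambda>d j. of_bool (j =
            (if d \<in> ?a then if d \<in> ?c then if d \<in> ?b then 3 else 4 else 2
             else if d \<in> ?c then 1 else 0))) :: (nat \<Rightarrow> 'u, 'f) matr)"
        proof (rule ten_cong)
          fix d j :: nat assume d: "d \<in> {1..n}"
          then have "f d \<le> 4" using f by auto
          then consider "f d = 0" | "f d = 1" | "f d = 2" | "f d = 3" | "f d = 4" by linarith
          then show "of_bool (j = f d) = (of_bool (j =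
            (if d \<in> ?a then if d \<in> ?c then if d \<in> ?b then 3 else 4 else 2
             else if d \<in> ?c then 1 else 0)) :: 'f)"
            using d by cases simp_all
        qed
      qed (use U x in \<open>auto simp: EE_def intro: finite_XX\<close>)
      moreover have "?a \<in> EE n" "?b \<in> EE n" "?c \<in> EE n" by (auto simp: EE_def)
      ultimately show ?thesis using B by (simp only:)
    qed
    have "ten n U x v \<in> S" for v
    proof -
      have "ten n U x v = (\<Sum>f\<in>Pi\<^sub>E {1..n} (\<lambda>_. {..4}). mat_scale (\<Prod>c\<in>{1..n}. v c (f c))
          (ten n U x (\<lambda>c j. of_bool (j = f c))))"
        by (rule ten_expand) (auto simp: if_distrib mult.commute of_bool_def cong: if_cong)
      also have "\<dots> \<in> S"
        by (intro mat.subspace_sum[OF sub] mat.subspace_scale[OF sub] unit) auto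
      finally show ?thesis .
    qed
    then show "?W \<subseteq> S" using sub by (intro mat.span_minimal) auto
  qed
qed

section \<open>Block idempotents\<close>

text \<open>The image of \<open>k_val U q\<close> in the field is a product, and a field has no zero
  divisors; characteristic 0 is included.\<close>

lemma not_CHAR_dvd_k_val:
  assumes "finite q"
  shows "\<not> CHAR('f::field) dvd k_val U q \<longleftrightarrow> (\<forall>a\<in>q. \<not> CHAR('f) dvd card (U a) - 1)"
  using assms by (simp add: k_val_def of_nat_eq_0_iff_char_dvd[symmetric])

text \<open>Expanding the tensor with factors \<open>w c\<close> into units gives one term for each
  pair of a triple in the class and a summand \<open>q\<close> of its \<open>D_mat\<close>; the sum
  defining the idempotent is this expansion.\<close>

lemma D_class_eq_ten:
  fixes n :: nat and U :: "nat \<Rightarrow> 'u set" and s :: "nat set"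
  defines "w \<equiv> \<lambda>c j :: nat. if c \<in> s
       then (if j = 3 then - inverse (of_nat (card (U c) - 1)) else of_bool (j = 4))
      else if c \<in> minus_part CHAR('f) U {1..n}
      then (if j = 3 then inverse (of_nat (card (U c) - 1)) else of_bool (j = 0))
      else of_bool (j = 0 \<or> j = 4)"
  assumes X: "finite (XX n U)" and x: "x \<in> XX n U"
    and s: "s \<subseteq> minus_part CHAR('f::field) U {1..n}"
  shows "D_class n U x {(a, b, c) \<in> diag_triples CHAR('f) n U. minus_part CHAR('f) U a - b = s} =
    (ten n U x w :: (nat \<Rightarrow> 'u, 'f) matr)"
proof -
  let ?m = "minus_part CHAR('f) U"
  let ?k = "\<lambda>c. of_nat (card (U c) - 1) :: 'f"
  let ?unit = "\<lambda>f c j :: nat. of_bool (j = (f c :: nat)) :: 'f"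
  \<comment> \<open>\<open>A\<close> lists the first components of the triples in the class,
    \<open>Q a\<close> the summation range of the \<open>D_mat\<close> belonging to
    \<open>a\<close>, and \<open>G c\<close> the units that occur in \<open>w c\<close>.\<close>
  define A where "A = {a. a \<subseteq> {1..n} \<and> s \<subseteq> ?m a}"
  define Q where "Q a = {q. ?m a - s \<subseteq> q \<and> q \<subseteq> ?m a}" for a
  define G :: "nat \<Rightarrow> nat set" where
    "G c = (if c \<in> s then {3, 4} else if c \<in> ?m {1..n} then {0, 3} else {0, 4})" for c
  define T :: "nat set \<Rightarrow> nat set \<Rightarrow> (nat \<Rightarrow> 'u, 'f) matr" where
    "T a q = mat_scale ((- 1) ^ card (q \<inter> s) * inverse (of_nat (k_val U q))) (B_mat n U x a q a)" for a q
  have fin: "finite V" if "V \<subseteq> {1..n}" for V :: "nat set"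
    using that by (rule finite_subset) simp
  have m_sub: "?m a \<subseteq> a" for a by (auto simp: minus_part_def)
  \<comment> \<open>An admissible \<open>q\<close> avoids the two-element alphabets and the places
    where the characteristic divides \<open>card (U c) - 1\<close>; the minus part of
    \<open>a\<close> is what is left.\<close>
  have m_iff: "q \<subseteq> circ U a \<and> \<not> CHAR('f) dvd k_val U q \<longleftrightarrow> q \<subseteq> ?m a" if "q \<subseteq> {1..n}" for a q
    using not_CHAR_dvd_k_val[where 'f='f, of q U] fin[OF that]
    by (auto simp: circ_def minus_part_def)
  have finA: "finite A"
    unfolding A_def by (rule finite_subset[of _ "Pow {1..n}"]) auto
  have finQ: "finite (Q a)" if "a \<in> A" for a
    unfolding Q_def using that m_sub[of a]
    by (intro finite_subset[of "{q. ?m a - s \<subseteq> q \<and> q \<subseteq> ?m a}" "Pow {1..n}"]) (auto simp: A_def)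
  \<comment> \<open>By \<open>m_iff\<close>, \<open>b\<close> lies in \<open>?m a\<close>; together
    with \<open>?m a - b = s\<close> this determines \<open>b\<close> from \<open>a\<close>.\<close>
  have C: "{(a, b, c) \<in> diag_triples CHAR('f) n U. ?m a - b = s} = (\<lambda>a. (a, ?m a - s, a)) ` A"
  proof (intro equalityI subsetI)
    fix t assume t_in: "t \<in> {(a, b, c) \<in> diag_triples CHAR('f) n U. ?m a - b = s}"
    obtain a b c where abc: "t = (a, b, c)" by (cases t)
    then have "c = a" using t_in by (simp add: diag_triples_def)
    then have t: "t = (a, b, a)" "a \<subseteq> {1..n}" "b \<subseteq> {1..n}" "b \<subseteq> circ U a"
      "\<not> CHAR('f) dvd k_val U b" "?m a - b = s"
      using t_in abc by (simp_all add: diag_triples_def PP_def EE_def)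
    have "b \<subseteq> ?m a" using m_iff[OF t(3), of a] t(4,5) by simp
    then have "b = ?m a - s" "a \<in> A" using t(2,6) by (auto simp: A_def)
    then show "t \<in> (\<lambda>a. (a, ?m a - s, a)) ` A" using t(1) by simp
  next
    fix t assume "t \<in> (\<lambda>a. (a, ?m a - s, a)) ` A"
    then obtain a where a: "t = (a, ?m a - s, a)" "a \<subseteq> {1..n}" "s \<subseteq> ?m a"
      by (auto simp: A_def)
    then have "?m a - s \<subseteq> {1..n}" using m_sub[of a] by auto
    then show "t \<in> {(a, b, c) \<in> diag_triples CHAR('f) n U. ?m a - b = s}"
      using a m_iff[of "?m a - s" a] by (auto simp: diag_triples_def PP_def EE_def)
  qed
  have D: "D_mat n U x a (?m a - s) a = (\<Sum>q\<in>Q a. T a q)" if a: "a \<in> A" for a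
    unfolding D_mat_def T_def
  proof (rule sum.cong)
    have sub: "q \<subseteq> {1..n}" if "q \<in> Q a" for q
      using that a m_sub[of a] by (auto simp: A_def Q_def)
    have "q \<in> EE n \<and> q \<subseteq> circ U a \<and> \<not> CHAR('f) dvd k_val U q \<longleftrightarrow> q \<in> EE n \<and> q \<subseteq> ?m a" for q
      using m_iff[of q a] by (auto simp only: EE_def Pow_iff)
    moreover have "Q a = {q \<in> EE n. ?m a - s \<subseteq> q \<and> q \<subseteq> ?m a}"
      using sub by (auto simp: Q_def EE_def)
    ultimately show "{q \<in> EE n. ?m a - s \<subseteq> q \<and> q \<subseteq> sym_diff a a \<union> circ U (a \<inter> a) \<and>
        \<not> CHAR('f) dvd k_val U q} = Q a"
      by (simp add: conj_ac cong: conj_cong) metis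
  next
    fix q assume "q \<in> Q a"
    then have "a \<inter> q = q" "q - (?m a - s) = q \<inter> s"
      using a m_sub[of a] by (auto simp: A_def Q_def)
    then show "mat_scale ((- 1) ^ card (q - (?m a - s)) * inverse (of_nat (k_val U (a \<inter> q))))
        (B_mat n U x a q a) =
      mat_scale ((- 1) ^ card (q \<inter> s) * inverse (of_nat (k_val U q))) (B_mat n U x a q a)"
      by simp
  qed
  \<comment> \<open>\<open>I\<close> and \<open>J\<close> are index maps, not matrices, and
    translate between choice functions and pairs \<open>(a, q)\<close>: code 3 marks the places in
    \<open>q\<close>, code 4 those in \<open>a\<close> outside \<open>q\<close>, code 0 those
    outside \<open>a\<close>.\<close>
  define I :: "(nat \<Rightarrow> nat) \<Rightarrow> nat set \<times> nat set" where
    "I f = ({c\<in>{1..n}. f c \<noteq> 0}, {c\<in>{1..n}. f c = 3})" for f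
  define J :: "nat set \<Rightarrow> nat set \<Rightarrow> nat \<Rightarrow> nat" where
    "J a q = (\<lambda>c\<in>{1..n}. if c \<in> q then 3 else if c \<in> a then 4 else 0)" for a q
  have IJ: "I (J a q) = (a, q) \<and> J a q \<in> Pi\<^sub>E {1..n} G \<and>
      mat_scale (\<Prod>c\<in>{1..n}. w c (J a q c)) (ten n U x (?unit (J a q))) = T a q"
    if aq: "a \<in> A" "q \<in> Q a" for a q
  proof -
    have sub: "a \<subseteq> {1..n}" "q \<subseteq> a" "q \<subseteq> ?m a" "s \<subseteq> ?m a" "?m a - s \<subseteq> q" "q \<subseteq> {1..n}"
      using aq m_sub[of a] by (auto simp: A_def Q_def)
    let ?f = "J a q"
    have 1: "I ?f = (a, q)"
      using sub by (auto simp: I_def J_def split: if_splits)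
    have m1: "c \<in> q" if "c \<in> a" "c \<in> ?m {1..n}" "c \<notin> s" for c
      using sub that by (auto simp: minus_part_def)
    have m2: "c \<in> ?m {1..n}" if "c \<in> q" for c
      using sub that by (auto simp: minus_part_def)
    have m3: "c \<in> a" if "c \<in> s" for c
      using sub that m_sub[of a] by auto
    have 2: "?f \<in> Pi\<^sub>E {1..n} G"
      by (auto simp: G_def J_def simp del: One_nat_def dest: m1 m2 m3)
    have "B_mat n U x a q a = (ten n U x (\<lambda>d j. of_bool (j =
        (if d \<in> a then if d \<in> a then if d \<in> q then 3 else 4 else 2 else if d \<in> a then 1 else 0)))
        :: (nat \<Rightarrow> 'u, 'f) matr)"
      using X x sub by (intro B_mat_eq_ten) (auto simp: EE_def)
    also have "\<dots> = ten n U x (?unit ?f)"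
      using sub by (intro ten_cong) (auto simp: J_def)
    finally have B: "B_mat n U x a q a = ten n U x (?unit ?f)" .
    \<comment> \<open>A factor can differ from 1 only at code 3, that is on \<open>q\<close>. There
      it is \<open>inverse (?k c)\<close>, with a minus sign on \<open>s\<close>, so the product is
      the coefficient in \<open>T a q\<close>.\<close>
    have "(\<Prod>c\<in>{1..n}. w c (?f c)) =
        (\<Prod>c\<in>{1..n}. if c \<in> q then (if c \<in> s then - 1 else 1) * inverse (?k c) else 1)"
      by (intro prod.cong) (auto simp: w_def J_def simp del: One_nat_def dest: m1 m2 m3)
    also have "\<dots> = (\<Prod>c\<in>q. (if c \<in> s then - 1 else 1) * inverse (?k c))"
      using sub by (simp add: prod.If_cases Int_absorb1 del: prod.distrib)
    also have "\<dots> = (\<Prod>c\<in>q. if c \<in> s then - 1 else 1) * inverse (\<Prod>c\<in>q. ?k c)"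
      using prod_inversef[of ?k q] by (simp add: prod.distrib o_def)
    also have "(\<Prod>c\<in>q. if c \<in> s then - 1 else 1 :: 'f) = (- 1) ^ card (q \<inter> s)"
      using fin[OF sub(6)] by (simp add: prod.If_cases)
    also have "(\<Prod>c\<in>q. ?k c) = of_nat (k_val U q)"
      by (simp add: k_val_def)
    finally have 3: "mat_scale (\<Prod>c\<in>{1..n}. w c (?f c)) (ten n U x (?unit ?f)) = T a q"
      by (simp only: T_def B)
    show "I ?f = (a, q) \<and> ?f \<in> Pi\<^sub>E {1..n} G \<and>
        mat_scale (\<Prod>c\<in>{1..n}. w c (?f c)) (ten n U x (?unit ?f)) = T a q"
      using 1 2 3 by blast
  qed
  have JI: "(\<lambda>(a, q). J a q) (I f) = f \<and> I f \<in> Sigma A Q" if f: "f \<in> Pi\<^sub>E {1..n} G" for f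
  proof -
    let ?a = "{c\<in>{1..n}. f c \<noteq> 0}" and ?q = "{c\<in>{1..n}. f c = 3}"
    have fG: "f c \<in> G c" if "c \<in> {1..n}" for c using f that by auto
    have 1: "J ?a ?q = f"
    proof
      fix c
      show "J ?a ?q c = f c"
        using f fG[of c] by (cases "c \<in> {1..n}")
          (auto simp: J_def G_def PiE_def extensional_def split: if_splits)
    qed
    have "s \<subseteq> ?m ?a"
    proof
      fix c assume c: "c \<in> s"
      then have "c \<in> {1..n}" "c \<in> ?m {1..n}" using s m_sub[of "{1..n}"] by auto
      then show "c \<in> ?m ?a" using fG[of c] c by (auto simp: minus_part_def G_def)
    qed
    then have 2: "?a \<in> A" by (auto simp: A_def)
    have "?m ?a - s \<subseteq> ?q"
    proof
      fix c assume c: "c \<in> ?m ?a - s"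
      then have "c \<in> {1..n}" "c \<in> ?m {1..n}" "f c \<noteq> 0" by (auto simp: minus_part_def)
      then show "c \<in> ?q" using fG[of c] c by (auto simp: G_def)
    qed
    moreover have "?q \<subseteq> ?m ?a"
    proof
      fix c assume c: "c \<in> ?q"
      then have "c \<in> ?m {1..n}" using fG[of c] s by (auto simp: G_def split: if_splits)
      then show "c \<in> ?m ?a" using c by (auto simp: minus_part_def)
    qed
    ultimately have "?q \<in> Q ?a" by (simp add: Q_def)
    with 1 2 show "(\<lambda>(a, q). J a q) (I f) = f \<and> I f \<in> Sigma A Q" by (simp add: I_def)
  qed
  have "D_class n U x {(a, b, c) \<in> diag_triples CHAR('f) n U. ?m a - b = s} = (\<Sum>a\<in>A. \<Sum>q\<in>Q a. T a q)"
    unfolding D_class_def C by (subst sum.reindex) (auto simp: inj_on_def D)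
  also have "\<dots> = (\<Sum>(a, q)\<in>Sigma A Q. T a q)"
    using finA finQ by (simp add: sum.Sigma)
  also have "\<dots> = (\<Sum>f\<in>Pi\<^sub>E {1..n} G. mat_scale (\<Prod>c\<in>{1..n}. w c (f c)) (ten n U x (?unit f)))"
    by (rule sum.reindex_bij_witness[where i = I and j = "\<lambda>(a, q). J a q"]) (use IJ JI in auto)
  also have "\<dots> = ten n U x w"
  proof (rule ten_expand[symmetric])
    fix c j :: nat assume c: "c \<in> {1..n}"
    show "w c j = (\<Sum>k\<in>G c. w c k * of_bool (j = k))"
      by (auto simp: w_def G_def)
  qed (auto simp: G_def)
  finally show ?thesis .
qed

section \<open>Dimension of a block\<close>

text \<open>In contrast to \<open>ten_cong\<close> this compares entries, so \<open>v 3\<close> and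
  \<open>v 4\<close> can be exchanged at a two-element alphabet.\<close>

lemma ten_loc_cong:
  assumes "\<And>c y z. c \<in> {1..n} \<Longrightarrow> y \<in> U c \<Longrightarrow> z \<in> U c \<Longrightarrow> loc (x c) (v c) y z = loc (x c) (w c) y z"
  shows "ten n U x v = ten n U x w"
proof (intro ext)
  fix y z
  have "(\<Prod>c\<in>{1..n}. loc (x c) (v c) (y c) (z c)) = (\<Prod>c\<in>{1..n}. loc (x c) (w c) (y c) (z c))"
    if "y \<in> XX n U" "z \<in> XX n U"
    using that by (intro prod.cong refl assms) (auto simp: XX_def)
  then show "ten n U x v y z = ten n U x w y z"
    by (simp add: ten_def)
qed

section \<open>Functionals dual to a tensor basis\<close>

definition pairing ::
  "nat \<Rightarrow> (nat \<Rightarrow> 'u set) \<Rightarrow> (nat \<Rightarrow> 'u \<Rightarrow> 'u \<Rightarrow> 'f::field) \<Rightarrow> (nat \<Rightarrow> 'u, 'f) matr \<Rightarrow> 'f" where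
  "pairing n U P M = (\<Sum>y\<in>XX n U. \<Sum>z\<in>XX n U. (\<Prod>c\<in>{1..n}. P c (y c) (z c)) * M y z)"

lemma pairing_linear:
  "pairing n U P (\<Sum>f\<in>F. mat_scale (c f) (b f)) = (\<Sum>f\<in>F. c f * pairing n U P (b f))"
proof -
  have "pairing n U P (\<Sum>f\<in>F. mat_scale (c f) (b f)) =
      (\<Sum>y\<in>XX n U. \<Sum>z\<in>XX n U. \<Sum>f\<in>F. c f * ((\<Prod>c\<in>{1..n}. P c (y c) (z c)) * b f y z))"
    unfolding pairing_def
    by (intro sum.cong refl) (simp add: sum_matr_apply mat_scale_def sum_distrib_left mult.left_commute)
  also have "\<dots> = (\<Sum>y\<in>XX n U. \<Sum>f\<in>F. \<Sum>z\<in>XX n U. c f * ((\<Prod>c\<in>{1..n}. P c (y c) (z c)) * b f y z))"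
    by (intro sum.cong refl sum.swap)
  also have "\<dots> = (\<Sum>f\<in>F. \<Sum>y\<in>XX n U. \<Sum>z\<in>XX n U. c f * ((\<Prod>c\<in>{1..n}. P c (y c) (z c)) * b f y z))"
    by (rule sum.swap)
  finally show ?thesis by (simp add: pairing_def sum_distrib_left)
qed

text \<open>The weights are products too, so the sums over columns and then over rows factor over
  the places. Dual functionals can therefore be built one place at a time.\<close>

lemma pairing_ten:
  assumes U: "\<And>a. a \<in> {1..n} \<Longrightarrow> finite (U a)"
  shows "pairing n U P (ten n U x v) =
    (\<Prod>c\<in>{1..n}. \<Sum>y\<in>U c. \<Sum>z\<in>U c. P c y z * loc (x c) (v c) y z)"
proof -
  have "pairing n U P (ten n U x v) =
      (\<Sum>y\<in>XX n U. \<Sum>z\<in>XX n U. \<Prod>c\<in>{1..n}. P c (y c) (z c) * loc (x c) (v c) (y c) (z c))"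
    unfolding pairing_def by (intro sum.cong refl) (simp add: ten_def prod.distrib)
  also have "\<dots> = (\<Sum>y\<in>XX n U. \<Prod>c\<in>{1..n}. \<Sum>z\<in>U c. P c (y c) z * loc (x c) (v c) (y c) z)"
    unfolding XX_def by (intro sum.cong refl prod_sum_PiE[symmetric]) (use U in auto)
  also have "\<dots> = (\<Prod>c\<in>{1..n}. \<Sum>y\<in>U c. \<Sum>z\<in>U c. P c y z * loc (x c) (v c) y z)"
    unfolding XX_def by (intro prod_sum_PiE[symmetric]) (use U in auto)
  finally show ?thesis .
qed

lemma sum_sum_of_bool:
  fixes G :: "'u \<Rightarrow> 'u \<Rightarrow> 'f::field"
  assumes "finite A" "p \<in> A" "q \<in> A"
  shows "(\<Sum>y\<in>A. \<Sum>z\<in>A. of_bool (y = p \<and> z = q) * G y z) = G p q"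
proof -
  have "(\<Sum>y\<in>A. \<Sum>z\<in>A. of_bool (y = p \<and> z = q) * G y z) =
      (\<Sum>y\<in>A. \<Sum>z\<in>A. if z = q then (if y = p then G y q else 0) else 0)"
    by (intro sum.cong refl) auto
  then show ?thesis using assms by simp
qed

text \<open>Products of local dual functionals show that the tensors of local basis vectors are
  independent. Index 4 is excluded at two-element alphabets, where its matrix coincides with that of
  index 3; the second alternative for \<open>N\<close> admits the single basis vector of a
  one-dimensional local ideal.\<close>

lemma dim_span_ten:
  fixes U :: "nat \<Rightarrow> 'u set" and N :: "nat \<Rightarrow> nat \<Rightarrow> nat \<Rightarrow> 'f::field"
  assumes U: "\<And>a. a \<in> {1..n} \<Longrightarrow> finite (U a) \<and> card (U a) \<ge> 2" and x: "x \<in> XX n U"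
    and K: "\<And>c. c \<in> {1..n} \<Longrightarrow> K c \<subseteq> {..4}"
    and K2: "\<And>c. c \<in> {1..n} \<Longrightarrow> card (U c) = 2 \<Longrightarrow> 4 \<notin> K c"
    and N: "\<And>c k. c \<in> {1..n} \<Longrightarrow> k \<in> K c \<Longrightarrow>
      N c k = (\<lambda>j. of_bool (j = k)) \<or> K c = {4} \<and> N c k 4 = 1"
  shows "mat_dim (mat.span ((\<lambda>f. ten n U x (\<lambda>c. N c (f c))) ` Pi\<^sub>E {1..n} K)) =
    (\<Prod>c\<in>{1..n}. card (K c))"
proof -
  \<comment> \<open>Test points off \<open>x c\<close>; they have to coincide when only one such
    point exists.\<close>
  have "\<exists>a b. a \<in> U c \<and> b \<in> U c \<and> a \<noteq> x c \<and> b \<noteq> x c \<and> (card (U c) = 2 \<or> a \<noteq> b)"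
    if c: "c \<in> {1..n}" for c
  proof -
    have xc: "x c \<in> U c" using x c by (auto simp: XX_def)
    then have "card (U c - {x c}) \<noteq> 0" using U[OF c] by (simp add: card_Diff_singleton)
    then obtain a where a: "a \<in> U c - {x c}" by (metis all_not_in_conv card.empty)
    show ?thesis
    proof (cases "card (U c) = 2")
      case False
      then have "card (U c - {x c} - {a}) \<noteq> 0"
        using U[OF c] xc a by (simp add: card_Diff_singleton)
      then obtain b where "b \<in> U c - {x c} - {a}" by (metis all_not_in_conv card.empty)
      then show ?thesis using a by blast
    qed (use a in blast)
  qed
  then obtain a b where ab: "\<And>c. c \<in> {1..n} \<Longrightarrow>
    a c \<in> U c \<and> b c \<in> U c \<and> a c \<noteq> x c \<and> b c \<noteq> x c \<and> (card (U c) = 2 \<or> a c \<noteq> b c)"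
    by metis
  let ?F = "Pi\<^sub>E {1..n} K" and ?b = "\<lambda>f. ten n U x (\<lambda>c. N c (f c))"
  \<comment> \<open>Coefficient \<open>k\<close> is read off at the entry \<open>(r c k, t c k)\<close>; only for \<open>k = 4\<close> the off-diagonal
    entry \<open>(a c, b c)\<close> has to be subtracted, as the diagonal entry is \<open>v 3 + v 4\<close>.\<close>
  define r where "r c k = (if k \<in> {0, 1::nat} then x c else a c)" for c k
  define t where "t c k = (if k \<in> {0, 2::nat} then x c else if k = 3 then b c else a c)" for c k
  define P where "P g c y z = of_bool (y = r c (g c) \<and> z = t c (g c)) -
    of_bool (g c = 4) * (of_bool (y = a c \<and> z = b c) :: 'f)" for g c y z
  have loc_dual: "(\<Sum>y\<in>U c. \<Sum>z\<in>U c. P g c y z * loc (x c) (N c k) y z) = of_bool (k = g c)"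
    if c: "c \<in> {1..n}" and k: "k \<in> K c" and g: "g c \<in> K c" for c g k
  proof -
    have xc: "x c \<in> U c" using x c by (auto simp: XX_def)
    have fin: "finite (U c)" using U[OF c] by simp
    have "(\<Sum>y\<in>U c. \<Sum>z\<in>U c. P g c y z * loc (x c) (N c k) y z) =
        (\<Sum>y\<in>U c. \<Sum>z\<in>U c. of_bool (y = r c (g c) \<and> z = t c (g c)) * loc (x c) (N c k) y z) -
        of_bool (g c = 4) * (\<Sum>y\<in>U c. \<Sum>z\<in>U c. of_bool (y = a c \<and> z = b c) * loc (x c) (N c k) y z)"
      by (simp add: P_def algebra_simps sum_subtractf sum_distrib_left)
    also have "\<dots> = loc (x c) (N c k) (r c (g c)) (t c (g c)) -
        of_bool (g c = 4) * loc (x c) (N c k) (a c) (b c)"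
    proof -
      have "r c (g c) \<in> U c" "t c (g c) \<in> U c"
        using xc ab[OF c] by (auto simp: r_def t_def)
      then show ?thesis
        using ab[OF c] fin by (simp only: sum_sum_of_bool)
    qed
    also have "\<dots> = of_bool (k = g c)"
    proof (cases "K c = {4} \<and> N c k 4 = 1")
      \<comment> \<open>Here 4 is in \<open>K c\<close>, so \<open>a c\<close> and
        \<open>b c\<close> differ, and the unspecified coefficient \<open>v 3\<close> cancels
        between the two entries.\<close>
      case True
      then show ?thesis
        using k g ab[OF c] K2[OF c] by (auto simp: loc_def r_def t_def)
    next
      case False
      then have Nk: "N c k = (\<lambda>j. of_bool (j = k))" using N[OF c k] by auto
      have "g c \<le> 4" using K[OF c] g by auto
      then consider "g c = 0" | "g c = 1" | "g c = 2" | "g c = 3" | "g c = 4" by linarith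
      then show ?thesis
        using k g ab[OF c] K2[OF c] by cases (auto simp: loc_def r_def t_def Nk)
    qed
    finally show ?thesis .
  qed
  have "mat_dim (mat.span (?b ` ?F)) = card ?F"
  proof (rule mat.dim_span_dual_family)
    show "finite ?F"
      using K by (intro finite_PiE) (auto intro: finite_subset)
    show "pairing n U (P g) (\<Sum>f\<in>?F. mat_scale (c f) (?b f)) = (\<Sum>f\<in>?F. c f * pairing n U (P g) (?b f))"
      for g c by (rule pairing_linear)
    show "pairing n U (P g) (?b f) = of_bool (f = g)" if fg: "f \<in> ?F" "g \<in> ?F" for f g
    proof -
      have "pairing n U (P g) (?b f) =
          (\<Prod>c\<in>{1..n}. \<Sum>y\<in>U c. \<Sum>z\<in>U c. P g c y z * loc (x c) (N c (f c)) y z)"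
        by (rule pairing_ten) (use U in auto)
      also have "\<dots> = (\<Prod>c\<in>{1..n}. of_bool (f c = g c))"
        using fg by (intro prod.cong refl loc_dual) auto
      also have "\<dots> = of_bool (\<forall>c\<in>{1..n}. f c = g c)"
        by (rule prod_of_bool) simp
      also have "(\<forall>c\<in>{1..n}. f c = g c) \<longleftrightarrow> f = g"
        using fg by (auto intro: PiE_ext)
      finally show ?thesis .
    qed
  qed
  then show ?thesis by (simp add: card_PiE)
qed

text \<open>The block is spanned by the products of tensors with the idempotent, hence by tensors of
  elements of local ideals. Multiplying by \<open>w c\<close> changes nothing on \<open>?p\<close>,
  keeps only multiples of \<open>w c\<close> on \<open>s\<close>, and elsewhere removes the
  coefficient 4, which leaves dimensions 5, 1 and 4.\<close>

lemma dim_block: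
  fixes n :: nat and U :: "nat \<Rightarrow> 'u set" and s :: "nat set"
  assumes U: "\<And>a. a \<in> {1..n} \<Longrightarrow> finite (U a) \<and> card (U a) \<ge> 2" and x: "x \<in> XX n U"
    and s: "s \<subseteq> minus_part CHAR('f::field) U {1..n}"
  shows "mat_dim (block_algebra n U x
      {(a, b, c) \<in> diag_triples CHAR('f) n U. minus_part CHAR('f) U a - b = s} :: (nat \<Rightarrow> 'u, 'f) matr set) =
    4 ^ (n - n_plus CHAR('f) n U - card s) * 5 ^ n_plus CHAR('f) n U"
proof -
  let ?k = "\<lambda>c. of_nat (card (U c) - 1) :: 'f"
  let ?p = "plus_part CHAR('f) U {1..n}"
  \<comment> \<open>Where \<open>card (U c) = 2\<close> this is the identity too, written with \<open>v 3\<close> instead of \<open>v 4\<close>, so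
    that these places need no separate treatment.\<close>
  define w :: "nat \<Rightarrow> nat \<Rightarrow> 'f" where
    "w c j = (if c \<in> ?p then of_bool (j = 0 \<or> j = 4)
      else if c \<in> s then (if j = 3 then - inverse (?k c) else of_bool (j = 4))
      else if j = 3 then inverse (?k c) else of_bool (j = 0))" for c j
  \<comment> \<open>\<open>N c k\<close> for \<open>k\<close> in \<open>K c\<close> is a basis of
    the local ideal generated by \<open>w c\<close>: all five units, the vector \<open>w c\<close>
    alone, or the units 0 to 3.\<close>
  define K :: "nat \<Rightarrow> nat set" where
    "K c = (if c \<in> ?p then {..4} else if c \<in> s then {4} else {..3})" for c
  define N where "N c k = (if c \<in> s then w c else (\<lambda>j. of_bool (j = k)))" for c k
  let ?F = "Pi\<^sub>E {1..n} K" and ?b = "\<lambda>f. ten n U x (\<lambda>c. N c (f c))"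
  have finU: "finite (U a)" if "a \<in> {1..n}" for a using U that by auto
  have s_p: "c \<notin> ?p" "c \<in> {1..n}" "card (U c) \<noteq> 2" if "c \<in> s" for c
    using s that by (auto simp: minus_part_def plus_part_def)
  have k0: "?k c \<noteq> 0" if "c \<notin> ?p" "c \<in> {1..n}" for c
    using that by (auto simp: plus_part_def of_nat_eq_0_iff_char_dvd simp del: of_nat_diff)
  \<comment> \<open>Alphabet size 2 would make the characteristic divide 1.\<close>
  have p2: "card (U c) \<noteq> 2" if "c \<in> ?p" for c
    using that CHAR_not_1' by (auto simp: plus_part_def)
  have D: "D_class n U x {(a, b, c) \<in> diag_triples CHAR('f) n U. minus_part CHAR('f) U a - b = s} =
      ten n U x w"
  proof (subst D_class_eq_ten[OF finite_XX[OF finU] x s], assumption, rule ten_loc_cong)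
    fix c y z assume c: "c \<in> {1..n}" and yz: "y \<in> U c" "z \<in> U c"
    have xc: "x c \<in> U c" using x c by (auto simp: XX_def)
    have eq: "y = z" if "card (U c) = 2" "y \<noteq> x c" "z \<noteq> x c"
    proof -
      have "card {x c, y, z} \<le> 2"
        using that(1) yz xc finU[OF c] by (metis card_mono empty_subsetI insert_subset)
      then show ?thesis using that by (auto split: if_splits simp: card_insert_if)
    qed
    show "loc (x c) (\<lambda>j. if c \<in> s then (if j = 3 then - inverse (?k c) else of_bool (j = 4))
      else if c \<in> minus_part CHAR('f) U {1..n}
      then (if j = 3 then inverse (?k c) else of_bool (j = 0))
      else of_bool (j = 0 \<or> j = 4)) y z = loc (x c) (w c) y z"
      using c eq s_p[of c] p2[of c]
      by (cases "card (U c) = 2") (auto simp: loc_def w_def minus_part_def plus_part_def)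
  qed
  have mult: "mat_mult (XX n U) (ten n U x v) (ten n U x u) =
      ten n U x (\<lambda>c. loc_mult (?k c) (v c) (u c))" for v u
    using finU x by (rule ten_mult)
  have T: "Terwilliger n U x = mat.span (range (ten n U x :: _ \<Rightarrow> (nat \<Rightarrow> 'u, 'f) matr))"
    using finU x by (rule Terwilliger_eq_span)
  interpret module_hom mat_scale mat_scale "\<lambda>M :: (nat \<Rightarrow> 'u, 'f) matr. mat_mult (XX n U) M (ten n U x w)"
    by (rule module_hom_mat_mult_left)
  \<comment> \<open>Right multiplication is linear, so the image of a span is the span of the
    image.\<close>
  have "block_algebra n U x {(a, b, c) \<in> diag_triples CHAR('f) n U. minus_part CHAR('f) U a - b = s} =
      mat.span (range (\<lambda>v. mat_mult (XX n U) (ten n U x v) (ten n U x w)))"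
    unfolding block_algebra_def D T span_image[symmetric] by (simp add: image_image)
  also have "\<dots> = mat.span (?b ` ?F)"
  proof (rule antisym; rule mat.span_minimal[OF _ mat.subspace_span])
    show "range (\<lambda>v. mat_mult (XX n U) (ten n U x v) (ten n U x w)) \<subseteq> mat.span (?b ` ?F)"
    proof clarify
      fix v :: "nat \<Rightarrow> nat \<Rightarrow> 'f"
      let ?u = "\<lambda>c. loc_mult (?k c) (v c) (w c)"
      \<comment> \<open>At a place in \<open>s\<close> the product with \<open>w c\<close> is
        \<open>v c 4\<close> times \<open>w c\<close>, as \<open>?k c\<close> cancels against its
        inverse; elsewhere the coefficients of \<open>?u c\<close> are used as they are.\<close>
      have "ten n U x ?u = (\<Sum>f\<in>?F. mat_scale
          (\<Prod>c\<in>{1..n}. (\<lambda>c k. if c \<in> s then v c 4 else ?u c k) c (f c)) (?b f))"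
      proof (rule ten_expand)
        fix c j :: nat assume c: "c \<in> {1..n}" and j: "j \<le> 4"
        show "?u c j = (\<Sum>k\<in>K c. (if c \<in> s then v c 4 else ?u c k) * N c k j)"
        proof (cases "c \<in> s")
          case True
          moreover consider "j = 0" | "j = 1" | "j = 2" | "j = 3" | "j = 4" using j by linarith
          ultimately show ?thesis
            using s_p[of c] k0[of c] by cases (auto simp: K_def N_def w_def loc_mult_def field_simps)
        next
          case False
          \<comment> \<open>Off \<open>?p\<close> and \<open>s\<close> the coefficient
            \<open>w c 4\<close> is 0, so unit 4 is not missed in \<open>K c\<close>.\<close>
          have "?u c 4 = 0" if "c \<notin> ?p" using that False by (simp add: loc_mult_def w_def)
          moreover have "(\<Sum>k\<in>K c. ?u c k * of_bool (j = k)) = (if j \<in> K c then ?u c j else 0)"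
            by (subst sum.delta[of "K c" j "\<lambda>k. ?u c k", symmetric])
              (auto simp: K_def intro!: sum.cong)
          moreover have "j = 4" if "j \<notin> K c" using that j False by (auto simp: K_def split: if_splits)
          ultimately show ?thesis using False by (auto simp: N_def K_def)
        qed
      qed (auto simp: K_def)
      also have "\<dots> \<in> mat.span (?b ` ?F)"
        by (intro mat.span_sum mat.span_scale mat.span_base) auto
      finally show "mat_mult (XX n U) (ten n U x v) (ten n U x w) \<in> mat.span (?b ` ?F)"
        by (simp only: mult)
    qed
    \<comment> \<open>Each local basis vector is fixed by right multiplication with
      \<open>w c\<close>, so the basis tensors are themselves such products.\<close>
    have "?b f = mat_mult (XX n U) (?b f) (ten n U x w)" if f: "f \<in> ?F" for f
      unfolding mult
    proof (rule ten_cong)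
      fix c j :: nat assume c: "c \<in> {1..n}" and j: "j \<le> 4"
      consider "j = 0" | "j = 1" | "j = 2" | "j = 3" | "j = 4" using j by linarith
      moreover have "f c \<in> K c" using f c by auto
      ultimately show "N c (f c) j = loc_mult (?k c) (N c (f c)) (w c) j"
        using s_p[of c] k0[OF _ c]
        by cases (auto simp: N_def w_def K_def loc_mult_def split: if_splits)
    qed
    then show "?b ` ?F \<subseteq> mat.span (range (\<lambda>v. mat_mult (XX n U) (ten n U x v) (ten n U x w)))"
      by (auto intro!: mat.span_base)
  qed
  also have "mat_dim \<dots> = (\<Prod>c\<in>{1..n}. card (K c))"
  proof (rule dim_span_ten[OF U x])
    fix c k assume c: "c \<in> {1..n}"
    show "K c \<subseteq> {..4}" by (auto simp: K_def)
    show "4 \<notin> K c" if "card (U c) = 2" using that s_p[of c] p2[of c] by (auto simp: K_def)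
    show "N c k = (\<lambda>j. of_bool (j = k)) \<or> K c = {4} \<and> N c k 4 = 1"
      using s_p[of c] by (auto simp: N_def K_def w_def)
  qed
  also have "\<dots> = (\<Prod>c\<in>{1..n}. if c \<in> ?p then 5 else if c \<in> s then 1 else 4)"
    by (intro prod.cong) (auto simp: K_def)
  also have "\<dots> = (\<Prod>c\<in>?p. 5) * (\<Prod>c\<in>{1..n} - ?p. if c \<in> s then 1 else 4)"
    by (subst prod.subset_diff[of ?p]) (auto simp: plus_part_def mult.commute intro!: arg_cong2[where f="(*)"] prod.cong)
  also have "(\<Prod>c\<in>{1..n} - ?p. if c \<in> s then 1 else 4) = (\<Prod>c\<in>{1..n} - ?p - s. 4 :: nat)"
    by (rule prod.mono_neutral_cong_right) auto
  also have "(\<Prod>c\<in>{1..n} - ?p - s. 4) = (4 :: nat) ^ (n - n_plus CHAR('f) n U - card s)"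
  proof -
    have "?p \<subseteq> {1..n}" "s \<subseteq> {1..n} - ?p" using s_p by (auto simp: plus_part_def)
    then have "card ({1..n} - ?p - s) = n - n_plus CHAR('f) n U - card s"
      by (simp add: card_Diff_subset finite_subset[of _ "{1..n}"] n_plus_def
          finite_subset[of s "{1..n} - ?p"])
    then show ?thesis by simp
  qed
  finally show ?thesis by (simp add: n_plus_def mult.commute)
qed

theorem theorem4p9:
  fixes n p g :: nat
    and U :: "nat \<Rightarrow> 'u set"
    and x :: "nat \<Rightarrow> 'u"
    and C :: "nat \<Rightarrow> (nat set \<times> nat set \<times> nat set) set"
    and h i :: "nat set"
  assumes p: "p = CHAR('f::field)"
    and n: "n \<ge> 1"
    and U: "\<And>a. a \<in> {1..n} \<Longrightarrow> finite (U a) \<and> card (U a) \<ge> 2"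
    and x: "x \<in> XX n U"
    and C: "bij_betw C {1..2 ^ n_minus p n U} (diag_triples p n U // approx_rel p n U)"
    and g: "g \<in> {1..2 ^ n_minus p n U}"
    and hi: "(h, i, h) \<in> C g"
  shows "(\<forall>h' i'. (h', i', h') \<in> C g \<longrightarrow> n_triple p U h' i' h' = n_triple p U h i h) \<and>
    mat_dim (block_algebra n U x (C g) :: (nat \<Rightarrow> 'u, 'f) matr set) =
      4 ^ (n - n_plus p n U - n_triple p U h i h) * 5 ^ n_plus p n U"
proof -
  let ?s = "minus_part p U h - i"
  have "C g \<in> diag_triples p n U // approx_rel p n U"
    using C g by (auto simp: bij_betw_def)
  then have Cg: "C g = approx_rel p n U `` {(h, i, h)}" and hi': "(h, i, h) \<in> diag_triples p n U"
    using hi equiv_approx_rel[of p n U] Union_quotient[OF equiv_approx_rel, of p n U]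
    by (auto elim!: quotientE simp: approx_rel_def)
  \<comment> \<open>The relation compares only \<open>minus_part p U a - b\<close>, so the class is
    the fibre of this value over \<open>?s\<close>. This gives both the constancy of
    \<open>n_triple\<close> and the form that \<open>dim_block\<close> expects.\<close>
  have eq: "C g = {(a, b, c) \<in> diag_triples p n U. minus_part p U a - b = ?s}"
    unfolding Cg using hi' by (auto simp: approx_rel_def)
  have nt: "n_triple p U a b a = card (minus_part p U a - b)" for a b
    by (simp add: n_triple_def)
  have "?s \<subseteq> minus_part p U {1..n}"
    using hi' by (auto simp: diag_triples_def PP_def EE_def minus_part_def)
  then have "mat_dim (block_algebra n U x (C g) :: (nat \<Rightarrow> 'u, 'f) matr set) =
      4 ^ (n - n_plus p n U - card ?s) * 5 ^ n_plus p n U"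
    unfolding eq using U x unfolding p by (intro dim_block) auto
  then show ?thesis
    by (auto simp: eq nt)
qed

end
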